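(* Let $R$ be a commutative ring and $\delta:R\to R$ a derivation. Let $N$ and $j$ be integers with $0\le j<N$, let $k$ be an integer with $0\le k\le N-j$, let $\vec u=(u_1,\dots,u_k)$ be a $k$-tuple of non-negative integers, and let $\vec f=(f_1,\dots,f_N)$ be an $N$-tuple with $f_h\in R$. Then $$F(j,\vec f,\vec u)=C(j,N,\vec u)\ \delta^{\,j-\sum_{i=1}^k u_i}\prod_{i=1}^N f_i,$$ where $$F(j,\vec f,\vec u)=\sum_{\tau\in T(N-j,k)}\ \sum_{s\in S(N,N-j)}\left(\prod_{i=1}^k\binom{|s_{\tau(i)}|-1}{u_i}\,\delta^{|s_{\tau(i)}|-1-u_i}\prod_{h\in s_{\tau(i)}}f_h\right)\left(\prod_{i\notin\tau}\delta^{|s_i|-1}\prod_{h\in s_i}f_h\right)$$ (a term being $0$ if $|s_{\tau(i)}|-1-u_i<0$ for some $i$, as the binomial coefficient is then equal to $0$), and $$C(j,N,\vec u)=\frac{(N-1)!\,\big(N-j+\sum_{i=1}^k u_i\big)}{(N-j-k)!\,\big(j-\sum_{i=1}^k u_i\big)!\,\prod_{i=1}^k (u_i)!\ \prod_{i=1}^k\big(k-i+1+\sum_{g=i}^k u_g\big)} .$$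
   Context: $[1,N]=\{1,\dots,N\}$. $S(N,m)$ is the set of set partitions of $[1,N]$ into $m$ parts, each written as an $m$-tuple $s=(s_1,\dots,s_m)$ of pairwise disjoint non-empty subsets with union $[1,N]$, ordered so that $\min(s_i)<\min(s_{i'})$ for $i<i'$. $T(m,k)$ is the set of $k$-element sets of integers $\tau=(\tau(1),\dots,\tau(k))$ in $[1,m]$ with $\tau(1)<\dots<\tau(k)$, also viewed as strictly increasing functions $[1,k]\to[1,m]$; $T(m,0)$ consists of one element, the empty set. In the product over $i\notin\tau$, $i$ ranges over $1\le i\le N-j$ with $i\notin\tau$. A derivation is an additive map with $\delta(fg)=\delta(f)g+f\delta(g)$; $\delta^n$ is its $n$-fold iterate and $\delta^0$ is the identity. Numbers multiply ring elements as integer multiples. *)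

theory Defs
  imports Complex_Main "HOL-Library.FuncSet" "HOL-Library.Disjoint_Sets"
begin

text \<open>
  Tuples are 1-based functions on natural numbers. The finite index objects
  (ordered set partitions and strictly increasing maps) are taken extensional,
  so that each of them is counted exactly once in a sum.
\<close>

definition derivation :: "('a::comm_ring_1 \<Rightarrow> 'a) \<Rightarrow> bool" where
  "derivation \<delta> \<longleftrightarrow>
     (\<forall>f g. \<delta> (f + g) = \<delta> f + \<delta> g) \<and> (\<forall>f g. \<delta> (f * g) = \<delta> f * g + f * \<delta> g)"

definition set_partitions :: "nat \<Rightarrow> nat \<Rightarrow> (nat \<Rightarrow> nat set) set" where
  "set_partitions N m =
     {s \<in> {1..m} \<rightarrow>\<^sub>E Pow {1..N}.
        (\<forall>i\<in>{1..m}. s i \<noteq> {}) \<and> disjoint_family_on s {1..m} \<and> (\<Union>i\<in>{1..m}. s i) = {1..N} \<and>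
        strict_mono_on {1..m} (\<lambda>i. Min (s i))}"

text \<open>
  A \<open>k\<close>-element subset of \<open>[1,m]\<close> is represented by its increasing enumeration \<open>\<tau>\<close>;
  the subset itself is the image of \<open>{1..k}\<close> under \<open>\<tau>\<close>.
\<close>

definition increasing_tuples :: "nat \<Rightarrow> nat \<Rightarrow> (nat \<Rightarrow> nat) set" where
  "increasing_tuples m k = {\<tau> \<in> {1..k} \<rightarrow>\<^sub>E {1..m}. strict_mono_on {1..k} \<tau>}"

text \<open>
  In the next definition the subtraction in the exponent \<open>card (s (\<tau> i)) - 1 - u i\<close> truncates
  only where the binomial coefficient in front of it is \<open>0\<close>.
\<close>

definition F_sum :: "('a::comm_ring_1 \<Rightarrow> 'a) \<Rightarrow> nat \<Rightarrow> nat \<Rightarrow> nat \<Rightarrow> (nat \<Rightarrow> 'a) \<Rightarrow> (nat \<Rightarrow> nat) \<Rightarrow> 'a" where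
  "F_sum \<delta> N j k f u =
     (\<Sum>\<tau>\<in>increasing_tuples (N - j) k. \<Sum>s\<in>set_partitions N (N - j).
        (\<Prod>i=1..k. of_nat ((card (s (\<tau> i)) - 1) choose u i) *
                    (\<delta> ^^ (card (s (\<tau> i)) - 1 - u i)) (\<Prod>h\<in>s (\<tau> i). f h)) *
        (\<Prod>i\<in>{1..N - j} - \<tau> ` {1..k}. (\<delta> ^^ (card (s i) - 1)) (\<Prod>h\<in>s i. f h)))"

text \<open>
  If \<open>j < u 1 + \<dots> + u k\<close>, the factor \<open>1 / (j - (u 1 + \<dots> + u k))!\<close> is the reciprocal of the
  factorial of a negative integer, which is read as \<open>0\<close>.
\<close>

definition C_coeff :: "nat \<Rightarrow> nat \<Rightarrow> nat \<Rightarrow> (nat \<Rightarrow> nat) \<Rightarrow> rat" where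
  "C_coeff j N k u =
     (if (\<Sum>i=1..k. u i) \<le> j then
        fact (N - 1) * of_nat (N - j + (\<Sum>i=1..k. u i)) /
        (fact (N - j - k) * fact (j - (\<Sum>i=1..k. u i)) * (\<Prod>i=1..k. fact (u i)) *
         (\<Prod>i=1..k. of_nat (k - i + 1 + (\<Sum>g=i..k. u g))))
      else 0)"

end

theory Submission
  imports Defs
begin

text \<open>
  Put \<open>E q B = ((card B - 1) choose (q - 1)) * \<delta>\<^sup>n (\<Prod>h\<in>B. f h)\<close> with \<open>n = card B - q\<close>. This is the
  operator form of the enumerator of rooted forests with \<open>q\<close> trees on \<open>B\<close>, and like that enumerator
  it satisfies, for a fixed \<open>a \<in> A\<close> and the sum over all \<open>B \<subseteq> A\<close> containing \<open>a\<close>,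
  \<open>\<Sum>B. E p B * E q (A - B) = ((p + q - 1) choose (p - 1)) * E (p + q) A\<close>.
  The identity is proved without division, since \<open>R\<close> may have torsion, by induction on \<open>A\<close>.
  Every term of \<open>F_sum\<close> is a product of factors \<open>E (v i + 1) (s i)\<close> with \<open>v (\<tau> i) = u i\<close> and \<open>v = 0\<close>
  off \<open>\<tau>\<close>. Splitting off the part that contains the least element, the identity evaluates the sum over
  the partitions as a natural number times \<open>E (N - j + \<Sum>u) {1..N}\<close>. The sum of these numbers over \<open>\<tau>\<close>
  obeys a recursion according to whether \<open>1 \<in> \<tau>\<close>, which the closed form also satisfies.
\<close>

section \<open>Convolution over subsets\<close>

text \<open>This is the product of exponential generating functions with labels kept; its
  commutativity and associativity let factors be moved freely below.\<close>

definition conv :: "('b set \<Rightarrow> 'a::comm_ring_1) \<Rightarrow> ('b set \<Rightarrow> 'a) \<Rightarrow> 'b set \<Rightarrow> 'a" where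
  "conv X Y A = (\<Sum>B\<in>Pow A. X B * Y (A - B))"

lemma conv_cong:
  assumes "\<And>B. B \<subseteq> A \<Longrightarrow> X B = X' B" and "\<And>B. B \<subseteq> A \<Longrightarrow> Y B = Y' B"
  shows "conv X Y A = conv X' Y' A"
  unfolding conv_def by (intro sum.cong) (auto simp: assms)

lemma conv_commute: "conv X Y = conv Y X"
proof
  fix A
  show "conv X Y A = conv Y X A" unfolding conv_def
    by (rule sum.reindex_bij_witness[where i="\<lambda>B. A - B" and j="\<lambda>B. A - B"])
       (auto simp: double_diff mult.commute)
qed

lemma conv_assoc: "conv (conv X Y) Z = conv X (conv Y Z)"
proof
  fix A
  show "conv (conv X Y) Z A = conv X (conv Y Z) A"
  proof (cases "finite A")
    case True
    have "conv (conv X Y) Z A = (\<Sum>B\<in>Pow A. \<Sum>C\<in>Pow B. X C * Y (B - C) * Z (A - B))"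
      by (simp add: conv_def sum_distrib_right)
    also have "\<dots> = (\<Sum>(B, C)\<in>(SIGMA B:Pow A. Pow B). X C * Y (B - C) * Z (A - B))"
      using True by (subst sum.Sigma) (auto intro: finite_subset)
    \<comment> \<open>A chain \<open>C \<subseteq> B \<subseteq> A\<close> is recorded by the
      disjoint sets \<open>C\<close> and \<open>D = B - C\<close>.\<close>
    also have "\<dots> = (\<Sum>(C, D)\<in>(SIGMA C:Pow A. Pow (A - C)). X C * (Y D * Z (A - C - D)))"
      by (rule sum.reindex_bij_witness[where i="\<lambda>(C, D). (C \<union> D, C)" and j="\<lambda>(B, C). (C, B - C)"])
         (auto simp: mult.assoc Diff_Diff_Int intro!: arg_cong2[where f=times] arg_cong[where f=Z] arg_cong[where f=Y])
    also have "\<dots> = (\<Sum>C\<in>Pow A. \<Sum>D\<in>Pow (A - C). X C * (Y D * Z (A - C - D)))"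
      using True by (subst sum.Sigma) (auto intro: finite_subset)
    also have "\<dots> = conv X (conv Y Z) A"
      by (simp add: conv_def sum_distrib_left)
    finally show ?thesis .
  qed (simp add: conv_def)
qed

lemma conv_left_commute: "conv X (conv Y Z) = conv Y (conv X Z)"
  by (metis conv_assoc conv_commute)

lemmas conv_ac = conv_assoc conv_commute conv_left_commute

lemma conv_scale_sum_left:
  "conv (\<lambda>B. \<Sum>i\<in>I. c i * X i B) Y A = (\<Sum>i\<in>I. c i * conv (X i) Y A)"
proof -
  have "conv (\<lambda>B. \<Sum>i\<in>I. c i * X i B) Y A = (\<Sum>B\<in>Pow A. \<Sum>i\<in>I. c i * (X i B * Y (A - B)))"
    by (simp add: conv_def sum_distrib_right mult.assoc)
  also have "\<dots> = (\<Sum>i\<in>I. \<Sum>B\<in>Pow A. c i * (X i B * Y (A - B)))"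
    by (rule sum.swap)
  finally show ?thesis by (simp add: conv_def sum_distrib_left)
qed

lemma sum_Pow_insert:
  assumes "finite A" "a \<notin> A"
  shows "sum X (Pow (insert a A)) = (\<Sum>B\<in>Pow A. X B) + (\<Sum>B\<in>Pow A. X (insert a B))"
proof -
  have "inj_on (insert a) (Pow A)"
    using assms by (auto simp: inj_on_def)
  moreover have "Pow A \<inter> insert a ` Pow A = {}"
    using assms by auto
  ultimately show ?thesis
    using assms by (simp add: Pow_insert sum.union_disjoint sum.reindex)
qed

section \<open>Forest polynomials of a derivation\<close>

locale derivation_family =
  fixes \<delta> :: "'a::comm_ring_1 \<Rightarrow> 'a" and f :: "'b \<Rightarrow> 'a"
  assumes deriv: "derivation \<delta>"
begin

lemma delta_add: "\<delta> (x + y) = \<delta> x + \<delta> y"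
  using deriv by (simp add: derivation_def)

lemma delta_mult: "\<delta> (x * y) = \<delta> x * y + x * \<delta> y"
  using deriv by (simp add: derivation_def)

lemma delta_0 [simp]: "\<delta> 0 = 0"
  using delta_add[of 0 0] by simp

lemma delta_sum: "\<delta> (\<Sum>x\<in>S. h x) = (\<Sum>x\<in>S. \<delta> (h x))"
  by (induction S rule: infinite_finite_induct) (auto simp: delta_add)

lemma delta_of_nat_mult: "\<delta> (of_nat n * x) = of_nat n * \<delta> x"
  by (induction n) (auto simp: delta_add distrib_right)

lemma delta_of_nat: "\<delta> (of_nat n) = 0"
proof -
  have "\<delta> 1 = 0" using delta_mult[of 1 1] by simp
  then show ?thesis using delta_of_nat_mult[of n 1] by simp
qed

text \<open>The usual Leibniz rule padded with zero terms, so that one bound \<open>M\<close> serves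
  all subsets of a finite set at once.\<close>

lemma Leibniz:
  assumes "n \<le> M"
  shows "(\<delta> ^^ n) (g * h) = (\<Sum>i\<le>M. (\<delta> ^^ i) g * (of_nat (n choose i) * (\<delta> ^^ (n - i)) h))"
proof -
  have *: "(\<delta> ^^ n) (g * h) = (\<Sum>i\<le>n. (\<delta> ^^ i) g * (of_nat (n choose i) * (\<delta> ^^ (n - i)) h))" for n
  proof (induction n)
    case (Suc n)
    let ?t = "\<lambda>i l. (\<delta> ^^ i) g * (\<delta> ^^ l) h"
    have "(\<delta> ^^ Suc n) (g * h) = \<delta> (\<Sum>i\<le>n. of_nat (n choose i) * ?t i (n - i))"
      using Suc.IH by (simp add: algebra_simps)
    also have "\<dots> = (\<Sum>i\<le>n. of_nat (n choose i) * ?t (Suc i) (n - i))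
        + (\<Sum>i\<le>n. of_nat (n choose i) * ?t i (Suc n - i))"
      by (simp add: delta_sum delta_mult delta_of_nat distrib_left sum.distrib Suc_diff_le)
    also have "(\<Sum>i\<le>n. of_nat (n choose i) * ?t i (Suc n - i))
        = (\<Sum>i\<le>Suc n. of_nat (n choose i) * ?t i (Suc n - i))"
      by (simp add: binomial_eq_0)
    also have "\<dots> = ?t 0 (Suc n) + (\<Sum>i\<le>n. of_nat (n choose Suc i) * ?t (Suc i) (n - i))"
      by (subst sum.atMost_Suc_shift) simp
    also have "(\<Sum>i\<le>n. of_nat (n choose i) * ?t (Suc i) (n - i)) + \<dots>
        = (\<Sum>i\<le>Suc n. of_nat (Suc n choose i) * ?t i (Suc n - i))"
      by (subst sum.atMost_Suc_shift) (simp add: sum.distrib algebra_simps)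
    finally show ?case by (simp only: mult.assoc mult.left_commute)
  qed simp
  show ?thesis unfolding *
    by (rule sum.mono_neutral_left) (use assms in \<open>auto simp: binomial_eq_0\<close>)
qed

text \<open>
  If \<open>\<delta>\<close> acts on \<open>\<Prod>h\<in>B. f h\<close> as multiplication by \<open>\<Sum>h\<in>B. x h\<close>, then \<open>forest q B\<close> is the
  generating polynomial, by numbers of children, of the rooted forests with \<open>q\<close> trees on \<open>B\<close>.
  Likewise \<open>pforest p g B\<close> belongs to the forests with \<open>p + 1\<close> trees on \<open>B\<close> together with
  one more vertex, whose variable is carried by \<open>g\<close>.
\<close>

definition forest :: "nat \<Rightarrow> 'b set \<Rightarrow> 'a" where
  "forest q B = (if B = {} then (if q = 0 then 1 else 0) else if q = 0 then 0
     else of_nat ((card B - 1) choose (q - 1)) * (\<delta> ^^ (card B - q)) (\<Prod>h\<in>B. f h))"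

definition pforest :: "nat \<Rightarrow> 'a \<Rightarrow> 'b set \<Rightarrow> 'a" where
  "pforest p g B = of_nat (card B choose p) * (\<delta> ^^ (card B - p)) (g * (\<Prod>h\<in>B. f h))"

lemma forest_insert:
  assumes "finite B" "a \<notin> B"
  shows "forest (Suc q) (insert a B) = pforest q (f a) B"
  using assms by (simp add: forest_def pforest_def)

text \<open>Where the subtraction truncates, the binomial coefficient is 0 on both sides; elsewhere
  the exponent really grows by one.\<close>

lemma delta_binomial_Suc:
  "\<delta> (of_nat (n choose Suc p) * (\<delta> ^^ (n - Suc p)) x) = of_nat (n choose Suc p) * (\<delta> ^^ (n - p)) x"
proof (cases "Suc p \<le> n")
  case True
  then have "n - p = Suc (n - Suc p)" by simp
  then show ?thesis by (simp add: delta_of_nat_mult)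
qed (simp add: binomial_eq_0)

text \<open>With \<open>card B = Suc n\<close>, this is Pascal's rule for
  \<open>Suc n choose q\<close>: all three terms carry the same power of
  \<open>\<delta>\<close>.\<close>

lemma delta_forest_Suc:
  assumes "finite B"
  shows "\<delta> (forest (Suc q) B) = pforest q 1 B - forest q B"
proof (cases "B = {}")
  case False
  then obtain n where n: "card B = Suc n"
    using assms by (metis card_eq_0_iff not0_implies_Suc)
  show ?thesis
  proof (cases q)
    case 0
    then show ?thesis using n False by (simp add: forest_def pforest_def)
  next
    case (Suc q')
    then show ?thesis using n False delta_binomial_Suc[of n q' "\<Prod>h\<in>B. f h"]
      by (simp add: forest_def pforest_def algebra_simps)
  qed
qed (auto simp: forest_def pforest_def binomial_eq_0)

lemma pforest_insert_0:
  assumes "finite B" "a \<notin> B"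
  shows "pforest 0 g (insert a B) = \<delta> (pforest 0 (g * f a) B)"
  using assms by (simp add: pforest_def mult.assoc)

lemma pforest_insert_Suc:
  assumes "finite B" "a \<notin> B"
  shows "pforest (Suc p) g (insert a B) = \<delta> (pforest (Suc p) (g * f a) B) + pforest p (g * f a) B"
  using assms delta_binomial_Suc[of "card B" p "g * f a * (\<Prod>h\<in>B. f h)"]
  by (simp add: pforest_def mult.assoc algebra_simps)

section \<open>The convolution identity for forests\<close>

lemma conv_forest_0:
  assumes "finite A"
  shows "conv X (forest 0) A = X A"
proof -
  have "conv X (forest 0) A = (\<Sum>B\<in>{A}. X B * forest 0 (A - B))"
    unfolding conv_def using assms by (intro sum.mono_neutral_right) (auto simp: forest_def)
  then show ?thesis by (simp add: forest_def)
qed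

lemma pforest_0_mult:
  assumes "card B \<le> M"
  shows "pforest 0 (g * h) B = (\<Sum>i\<le>M. (\<delta> ^^ i) g * pforest i h B)"
  using Leibniz[OF assms, of g "h * (\<Prod>h\<in>B. f h)"] by (simp add: pforest_def mult.assoc)

text \<open>
  The factors of the two marked vertices can be moved to one side: both sides are the convolution of
  \<open>forest p\<close>, \<open>forest q\<close> and \<open>\<Sum>i. \<delta>\<^sup>i g (forest i * pforest 0 1 * pforest 0 h)\<close>.
\<close>

lemma conv_pforest_pforest:
  assumes fin: "finite A"
    and abs: "\<And>B p g. B \<subseteq> A \<Longrightarrow> conv (pforest 0 g) (forest p) B = pforest p g B"
  shows "conv (pforest p g) (pforest q h) A = conv (pforest p (g * h)) (pforest q 1) A"
proof -
  \<comment> \<open>\<open>abs\<close> makes \<open>pforest p\<close> the convolution of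
    \<open>pforest 0\<close> with \<open>forest p\<close>. The case \<open>p = q = 0\<close> comes
    first, expanding \<open>g\<close> by the Leibniz rule.\<close>
  have zero: "conv (pforest 0 g) (pforest 0 h) B = conv (pforest 0 (g * h)) (pforest 0 1) B"
    if B: "B \<subseteq> A" for B
  proof -
    have c: "card C \<le> card A" if "C \<subseteq> B" for C
      using that B fin by (meson card_mono subset_trans)
    have "conv (pforest 0 g) (pforest 0 h) B
        = conv (\<lambda>C. \<Sum>i\<le>card A. (\<delta> ^^ i) g * pforest i 1 C) (pforest 0 h) B"
      using pforest_0_mult[where h=1] c by (intro conv_cong) auto
    also have "\<dots> = (\<Sum>i\<le>card A. (\<delta> ^^ i) g * conv (pforest i 1) (pforest 0 h) B)"
      by (rule conv_scale_sum_left)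
    also have "\<dots> = (\<Sum>i\<le>card A. (\<delta> ^^ i) g * conv (pforest i h) (pforest 0 1) B)"
    proof (intro sum.cong refl arg_cong2[where f=times])
      fix i
      have "conv (pforest i 1) (pforest 0 h) B
          = conv (conv (pforest 0 1) (forest i)) (pforest 0 h) B"
        using B abs by (intro conv_cong) auto
      also have "\<dots> = conv (conv (pforest 0 h) (forest i)) (pforest 0 1) B"
        by (simp only: conv_ac)
      also have "\<dots> = conv (pforest i h) (pforest 0 1) B"
        using B abs by (intro conv_cong) auto
      finally show "conv (pforest i 1) (pforest 0 h) B = conv (pforest i h) (pforest 0 1) B" .
    qed
    also have "\<dots> = conv (\<lambda>C. \<Sum>i\<le>card A. (\<delta> ^^ i) g * pforest i h C) (pforest 0 1) B"
      by (rule conv_scale_sum_left[symmetric])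
    also have "\<dots> = conv (pforest 0 (g * h)) (pforest 0 1) B"
      using c by (intro conv_cong) (auto intro!: pforest_0_mult[symmetric])
    finally show ?thesis .
  qed
  \<comment> \<open>By \<open>abs\<close>, the factors \<open>forest p\<close> and
    \<open>forest q\<close> split off and leave the two treated in \<open>zero\<close>.\<close>
  have split: "conv (pforest p g) (pforest q h) A
      = conv (conv (pforest 0 g) (pforest 0 h)) (conv (forest p) (forest q)) A" for g h
  proof -
    have "conv (pforest p g) (pforest q h) A
        = conv (conv (pforest 0 g) (forest p)) (conv (pforest 0 h) (forest q)) A"
      using abs by (intro conv_cong) auto
    then show ?thesis by (simp only: conv_ac)
  qed
  show ?thesis
    unfolding split by (rule conv_cong) (erule zero, rule refl)
qed

text \<open>Fixing a point \<open>a\<close> of \<open>A\<close> gives two sums, for \<open>a\<close>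
  outside and inside \<open>B\<close>. In the first, \<open>f a\<close> is transferred to the other
  factor; in the second, \<open>pforest\<close> is expanded by its recursion. Pulling
  \<open>\<delta>\<close> out of the second creates a correction that cancels the first up to a
  smaller instance, and Pascal's rule adds up the rest.\<close>

lemma conv_pforest_forest:
  assumes "finite A"
  shows "conv (pforest p g) (forest q) A = of_nat ((p + q) choose p) * pforest (p + q) g A"
  using assms
proof (induction A arbitrary: p q g rule: finite_psubset_induct)
  case (psubset A)
  show ?case
  proof (cases "A = {} \<or> q = 0")
    case True
    then show ?thesis
      using psubset.hyps by (cases q) (auto simp: conv_forest_0, simp add: conv_def forest_def pforest_def)
  next
    case False
    then obtain a A' q' where A: "A = insert a A'" "a \<notin> A'" and q: "q = Suc q'"
      by (metis Set.set_insert all_not_in_conv not0_implies_Suc)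
    have fin: "finite A'" using psubset.hyps A by simp
    have finB: "finite B" "a \<notin> B" "finite (A' - B)" "a \<notin> A' - B" if "B \<in> Pow A'" for B
      using that fin A by (auto intro: finite_subset)
    define h where "h = g * f a"
    have IH: "conv (pforest p g) (forest q) B = of_nat ((p + q) choose p) * pforest (p + q) g B"
      if "B \<subseteq> A'" for B p q g
      using that A by (intro psubset.IH) auto
    \<comment> \<open>The induction hypothesis with \<open>p = 0\<close>, available on every subset
      of \<open>A'\<close>, is the absorption property required here.\<close>
    have transfer: "conv (pforest p g) (pforest q' (f a)) A' = conv (pforest p h) (pforest q' 1) A'"
      unfolding h_def by (rule conv_pforest_pforest) (auto simp: fin IH)
    \<comment> \<open>The contribution of the second summand of \<open>pforest_insert_Suc\<close>,
      which is absent for \<open>p = 0\<close>.\<close>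
    define P where "P = (if p = 0 then 0 else of_nat ((p - 1 + q) choose (p - 1)) * pforest (p + q') h A')"
    have "conv (pforest p g) (forest q) A
        = (\<Sum>B\<in>Pow A'. pforest p g B * forest q (insert a (A' - B)))
          + (\<Sum>B\<in>Pow A'. pforest p g (insert a B) * forest q (A' - B))"
    proof -
      have "insert a A' - B = insert a (A' - B)" "insert a A' - insert a B = A' - B" if "B \<in> Pow A'" for B
        using that A by auto
      then show ?thesis
        unfolding conv_def A using fin A(2) by (simp add: sum_Pow_insert)
    qed
    also have "(\<Sum>B\<in>Pow A'. pforest p g B * forest q (insert a (A' - B)))
        = conv (pforest p g) (pforest q' (f a)) A'"
      unfolding conv_def q by (intro sum.cong) (auto simp: forest_insert finB)
    also have "(\<Sum>B\<in>Pow A'. pforest p g (insert a B) * forest q (A' - B))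
        = (\<Sum>B\<in>Pow A'. \<delta> (pforest p h B) * forest q (A' - B)) + P"
    proof (cases p)
      case 0
      then show ?thesis by (auto simp: P_def h_def pforest_insert_0 finB intro!: sum.cong)
    next
      case (Suc p')
      have "(\<Sum>B\<in>Pow A'. pforest p g (insert a B) * forest q (A' - B))
        = (\<Sum>B\<in>Pow A'. \<delta> (pforest p h B) * forest q (A' - B)) + conv (pforest p' h) (forest q) A'"
        unfolding conv_def sum.distrib[symmetric] Suc
        by (intro sum.cong) (auto simp: pforest_insert_Suc finB h_def algebra_simps)
      then show ?thesis by (simp add: IH P_def Suc q)
    qed
    \<comment> \<open>The product rule moves \<open>\<delta>\<close> outside; the derivative of the
      \<open>forest q\<close> factor is the difference in \<open>delta_forest_Suc\<close>.\<close>
    also have "(\<Sum>B\<in>Pow A'. \<delta> (pforest p h B) * forest q (A' - B))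
        = \<delta> (conv (pforest p h) (forest q) A')
          - (conv (pforest p h) (pforest q' 1) A' - conv (pforest p h) (forest q') A')"
    proof -
      have "\<delta> (conv (pforest p h) (forest q) A')
          = (\<Sum>B\<in>Pow A'. \<delta> (pforest p h B) * forest q (A' - B))
            + (\<Sum>B\<in>Pow A'. pforest p h B * \<delta> (forest q (A' - B)))"
        by (simp add: conv_def delta_sum delta_mult sum.distrib)
      also have "(\<Sum>B\<in>Pow A'. pforest p h B * \<delta> (forest q (A' - B)))
          = conv (pforest p h) (pforest q' 1) A' - conv (pforest p h) (forest q') A'"
        unfolding conv_def sum_subtractf[symmetric] q
        by (intro sum.cong) (auto simp: delta_forest_Suc finB algebra_simps)
      finally show ?thesis by simp
    qed
    \<comment> \<open>By \<open>transfer\<close>, the convolution with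
      \<open>pforest q' (f a)\<close> cancels the subtracted one with
      \<open>pforest q' 1\<close>.\<close>
    finally have "conv (pforest p g) (forest q) A
        = of_nat ((p + q) choose p) * \<delta> (pforest (p + q) h A')
          + of_nat ((p + q') choose p) * pforest (p + q') h A' + P"
      by (simp add: transfer IH delta_of_nat_mult)
    also have "\<dots> = of_nat ((p + q) choose p) * (\<delta> (pforest (p + q) h A') + pforest (p + q') h A')"
    proof (cases p)
      case (Suc p')
      have "of_nat ((p + q') choose p) * pforest (p + q') h A' + P
          = of_nat (((p + q') choose p) + ((p + q') choose p')) * pforest (p + q') h A'"
        by (simp add: P_def Suc q algebra_simps)
      also have "((p + q') choose p) + ((p + q') choose p') = (p + q) choose p"
        by (simp add: Suc q)
      finally show ?thesis by (simp add: algebra_simps)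
    qed (simp add: P_def algebra_simps)
    also have "\<delta> (pforest (p + q) h A') + pforest (p + q') h A' = pforest (p + q) g A"
      using pforest_insert_Suc[of A' a "p + q'" g] fin A by (simp add: q h_def)
    finally show ?thesis .
  qed
qed

text \<open>Removing \<open>a\<close> reduces this to \<open>conv_pforest_forest\<close> with
  \<open>g = f a\<close>. For forests, the binomial coefficient chooses which \<open>p\<close> of
  the \<open>p + q\<close> trees avoiding \<open>a\<close> join the tree of \<open>a\<close> in
  \<open>B\<close>.\<close>

lemma sum_forest_forest:
  assumes "finite A" "a \<in> A"
  shows "(\<Sum>B\<in>{B. a \<in> B \<and> B \<subseteq> A}. forest (Suc p) B * forest q (A - B))
    = of_nat ((p + q) choose p) * forest (Suc (p + q)) A"
proof -
  define A' where "A' = A - {a}"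
  have A: "A = insert a A'" "a \<notin> A'" "finite A'" using assms by (auto simp: A'_def)
  have "(\<Sum>B\<in>{B. a \<in> B \<and> B \<subseteq> A}. forest (Suc p) B * forest q (A - B))
      = conv (pforest p (f a)) (forest q) A'"
    unfolding conv_def
  proof (rule sum.reindex_bij_witness[where i="insert a" and j="\<lambda>B. B - {a}"])
    fix B assume B: "B \<in> {B. a \<in> B \<and> B \<subseteq> A}"
    then have "forest (Suc p) (insert a (B - {a})) = pforest p (f a) (B - {a})"
      using assms by (intro forest_insert) (auto intro: finite_subset)
    moreover have "A' - (B - {a}) = A - B" using B by (auto simp: A'_def)
    ultimately show "pforest p (f a) (B - {a}) * forest q (A' - (B - {a})) = forest (Suc p) B * forest q (A - B)"
      using B by (simp add: insert_absorb)
  qed (use assms in \<open>auto simp: A'_def\<close>)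
  then show ?thesis using A by (simp add: conv_pforest_forest forest_insert)
qed

end

section \<open>Ordered set partitions\<close>

text \<open>Like \<open>tail\<close>, it restricts to the index interval, so that the two are
  mutually inverse on extensional functions.\<close>

definition prepend :: "nat \<Rightarrow> 'b \<Rightarrow> (nat \<Rightarrow> 'b) \<Rightarrow> nat \<Rightarrow> 'b" where
  "prepend m x s = (\<lambda>i\<in>{1..Suc m}. if i = 1 then x else s (i - 1))"

definition tail :: "nat \<Rightarrow> (nat \<Rightarrow> 'b) \<Rightarrow> nat \<Rightarrow> 'b" where
  "tail m s = (\<lambda>i\<in>{1..m}. s (Suc i))"

lemma prepend_1 [simp]: "prepend m x s (Suc 0) = x"
  by (simp add: prepend_def)

lemma prepend_Suc [simp]: "i \<in> {1..m} \<Longrightarrow> prepend m x s (Suc i) = s i"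
  by (simp add: prepend_def)

lemma prepend_tail:
  assumes "s \<in> extensional {1..Suc m}"
  shows "prepend m (s 1) (tail m s) = s"
proof
  fix i
  show "prepend m (s 1) (tail m s) i = s i"
    using assms by (cases i) (auto simp: prepend_def tail_def extensional_def)
qed

lemma tail_prepend:
  assumes "s \<in> extensional {1..m}"
  shows "tail m (prepend m x s) = s"
proof
  fix i
  show "tail m (prepend m x s) i = s i"
    using assms by (auto simp: prepend_def tail_def extensional_def)
qed

lemma atLeast1_atMost_Suc: "{1..Suc m} = insert 1 (Suc ` {1..m})"
  by auto

text \<open>The image of \<open>{1..m}\<close> under \<open>Suc\<close> must stay an image for the
  splitting in \<open>atLeast1_atMost_Suc\<close>.\<close>

declare image_Suc_atLeastAtMost [simp del]

lemma strict_mono_on_Suc_iff: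
  fixes g :: "nat \<Rightarrow> nat"
  shows "strict_mono_on {1..Suc m} g \<longleftrightarrow>
    (\<forall>i\<in>{1..m}. g 1 < g (Suc i)) \<and> strict_mono_on {1..m} (\<lambda>i. g (Suc i))"
  unfolding strict_mono_on_def atLeast1_atMost_Suc by (auto)

lemma disjoint_family_on_Suc_iff:
  "disjoint_family_on s {1..Suc m} \<longleftrightarrow>
    (\<forall>i\<in>{1..m}. s 1 \<inter> s (Suc i) = {}) \<and> disjoint_family_on (\<lambda>i. s (Suc i)) {1..m}"
  unfolding disjoint_family_on_def atLeast1_atMost_Suc by simp blast

lemma prod_atLeast1_atMost_Suc: "(\<Prod>i=1..Suc m. h i) = h 1 * (\<Prod>i=1..m. h (Suc i))"
  unfolding atLeast1_atMost_Suc by (subst prod.insert) (auto simp: prod.reindex)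

lemma sum_atLeast1_atMost_Suc: "(\<Sum>i=1..Suc m. h i) = h 1 + (\<Sum>i=1..m. h (Suc i))"
  unfolding atLeast1_atMost_Suc by (subst sum.insert) (auto simp: sum.reindex)

text \<open>Deleting the first part of a partition of an interval need not leave an interval, so the
  ground set is arbitrary here.\<close>

definition set_partitions_on :: "nat set \<Rightarrow> nat \<Rightarrow> (nat \<Rightarrow> nat set) set" where
  "set_partitions_on A m =
     {s \<in> {1..m} \<rightarrow>\<^sub>E Pow A.
        (\<forall>i\<in>{1..m}. s i \<noteq> {}) \<and> disjoint_family_on s {1..m} \<and> (\<Union>i\<in>{1..m}. s i) = A \<and>
        strict_mono_on {1..m} (\<lambda>i. Min (s i))}"

lemma set_partitions_on_iff:
  "s \<in> set_partitions_on A m \<longleftrightarrow>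
     s \<in> extensional {1..m} \<and> (\<forall>i\<in>{1..m}. s i \<noteq> {}) \<and> disjoint_family_on s {1..m} \<and>
     (\<Union>i\<in>{1..m}. s i) = A \<and> strict_mono_on {1..m} (\<lambda>i. Min (s i))"
  unfolding set_partitions_on_def PiE_def by auto

lemma finite_set_partitions_on: "finite A \<Longrightarrow> finite (set_partitions_on A m)"
  by (rule finite_subset[of _ "{1..m} \<rightarrow>\<^sub>E Pow A"]) (auto simp: set_partitions_on_def intro!: finite_PiE)

text \<open>A later part holding the least element would have a minimum no greater than that of the
  first part, against the order of the minima.\<close>

lemma set_partitions_on_SucD:
  assumes "finite A" "s \<in> set_partitions_on A (Suc m)"
  shows "Min A \<in> s 1" "s 1 \<subseteq> A" "tail m s \<in> set_partitions_on (A - s 1) m"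
proof -
  note s = assms(2)[unfolded set_partitions_on_iff strict_mono_on_Suc_iff disjoint_family_on_Suc_iff]
  have un: "A = s 1 \<union> (\<Union>i\<in>{1..m}. s (Suc i))"
    using s unfolding atLeast1_atMost_Suc by auto
  have ne: "s 1 \<noteq> {}" using s by auto
  have fin: "finite (s 1)" "\<And>i. i \<in> {1..m} \<Longrightarrow> finite (s (Suc i))"
    using assms(1) un by (auto intro: finite_subset)
  show "s 1 \<subseteq> A" using un by auto
  show "Min A \<in> s 1"
  proof (rule ccontr)
    assume *: "Min A \<notin> s 1"
    have "Min A \<in> A" using assms(1) un ne by (intro Min_in) auto
    then obtain i where i: "i \<in> {1..m}" "Min A \<in> s (Suc i)" using un * by auto
    have "Min (s (Suc i)) \<le> Min A" using i fin by auto
    moreover have "Min A \<le> Min (s 1)"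
      using assms(1) un ne Min_in[OF fin(1) ne] by (intro Min_le) auto
    moreover have "Min (s 1) < Min (s (Suc i))" using s i by auto
    ultimately show False by simp
  qed
  have "(\<Union>i\<in>{1..m}. s (Suc i)) = A - s 1"
    using un s by auto
  moreover have "strict_mono_on {1..m} (\<lambda>i. Min (tail m s i))"
    using s by (auto simp: tail_def strict_mono_on_def)
  moreover have "disjoint_family_on (tail m s) {1..m}"
    using s by (auto simp: tail_def disjoint_family_on_def)
  ultimately show "tail m s \<in> set_partitions_on (A - s 1) m"
    using s unfolding set_partitions_on_iff by (auto simp: tail_def)
qed

lemma prepend_in_set_partitions_on:
  assumes A: "finite A" and B: "Min A \<in> B" "B \<subseteq> A" and t: "t \<in> set_partitions_on (A - B) m"
  shows "prepend m B t \<in> set_partitions_on A (Suc m)"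
proof -
  note t = t[unfolded set_partitions_on_iff]
  have sub: "t i \<subseteq> A - B" if "i \<in> {1..m}" for i
    using t that by auto
  have finB: "finite B" using A B finite_subset by auto
  \<comment> \<open>The other parts avoid \<open>Min A\<close>, so their minima exceed it, whereas
    \<open>B\<close> contains it.\<close>
  have Min_less: "Min B < Min (t i)" if i: "i \<in> {1..m}" for i
  proof -
    have "finite (t i)" "t i \<noteq> {}" using sub[OF i] A t i by (auto intro: finite_subset)
    then have m: "Min (t i) \<in> A" "Min (t i) \<notin> B" using Min_in sub[OF i] by blast+
    then have "Min A \<le> Min (t i)" "Min A \<noteq> Min (t i)" using A B by auto
    moreover have "Min B \<le> Min A" using finB B by auto
    ultimately show ?thesis by simp
  qed
  have disj: "B \<inter> t i = {}" if "i \<in> {1..m}" for i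
    using sub[OF that] by blast
  have "strict_mono_on {1..m} (\<lambda>i. Min (prepend m B t (Suc i)))"
    using t by (auto simp: strict_mono_on_def)
  moreover have "disjoint_family_on (\<lambda>i. prepend m B t (Suc i)) {1..m}"
    using t by (auto simp: disjoint_family_on_def)
  moreover have "(\<Union>i\<in>{1..Suc m}. prepend m B t i) = A"
    unfolding atLeast1_atMost_Suc using t B by auto
  moreover have "\<forall>i\<in>{1..Suc m}. prepend m B t i \<noteq> {}"
    unfolding atLeast1_atMost_Suc using t B by auto
  moreover have "\<forall>i\<in>{1..m}. prepend m B t 1 \<inter> prepend m B t (Suc i) = {}"
    using disj by simp
  moreover have "\<forall>i\<in>{1..m}. Min (prepend m B t 1) < Min (prepend m B t (Suc i))"
    using Min_less by simp
  moreover have "prepend m B t \<in> extensional {1..Suc m}"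
    by (simp add: prepend_def)
  ultimately show ?thesis
    unfolding set_partitions_on_iff strict_mono_on_Suc_iff disjoint_family_on_Suc_iff by blast
qed

lemma sum_set_partitions_on_Suc:
  assumes "finite A"
  shows "(\<Sum>s\<in>set_partitions_on A (Suc m). h (s 1) (tail m s))
    = (\<Sum>B\<in>{B. Min A \<in> B \<and> B \<subseteq> A}. \<Sum>t\<in>set_partitions_on (A - B) m. h B t)"
proof -
  have "(\<Sum>s\<in>set_partitions_on A (Suc m). h (s 1) (tail m s))
      = (\<Sum>(B, t)\<in>(SIGMA B:{B. Min A \<in> B \<and> B \<subseteq> A}. set_partitions_on (A - B) m). h B t)"
  proof (rule sum.reindex_bij_witness[where i="\<lambda>(B, t). prepend m B t" and j="\<lambda>s. (s 1, tail m s)"])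
    fix s assume "s \<in> set_partitions_on A (Suc m)"
    then show "(case (s 1, tail m s) of (B, t) \<Rightarrow> prepend m B t) = s"
      using prepend_tail[of s m] by (simp add: set_partitions_on_iff)
  next
    fix x assume "x \<in> (SIGMA B:{B. Min A \<in> B \<and> B \<subseteq> A}. set_partitions_on (A - B) m)"
    then show "((case x of (B, t) \<Rightarrow> prepend m B t) 1, tail m (case x of (B, t) \<Rightarrow> prepend m B t)) = x"
      by (auto simp: tail_prepend set_partitions_on_iff)
  qed (use set_partitions_on_SucD[OF assms] prepend_in_set_partitions_on[OF assms] in auto)
  also have "\<dots> = (\<Sum>B\<in>{B. Min A \<in> B \<and> B \<subseteq> A}. \<Sum>t\<in>set_partitions_on (A - B) m. h B t)"
    using assms by (subst sum.Sigma) (auto intro: finite_set_partitions_on)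
  finally show ?thesis .
qed

text \<open>
  The number of ways to distribute the trees of a forest over \<open>m\<close> parts, the \<open>i\<close>-th of which
  receives \<open>v i + 1\<close> trees, where each part contains the least tree not in an earlier part.
\<close>

fun split_count :: "nat \<Rightarrow> (nat \<Rightarrow> nat) \<Rightarrow> nat" where
  "split_count 0 v = 1"
| "split_count (Suc m) v =
     ((m + (\<Sum>i=1..Suc m. v i)) choose v 1) * split_count m (\<lambda>i. v (Suc i))"

lemma split_count_cong:
  assumes "\<And>i. i \<in> {1..m} \<Longrightarrow> v i = w i"
  shows "split_count m v = split_count m w"
  using assms
proof (induction m arbitrary: v w)
  case (Suc m)
  have "split_count m (\<lambda>i. v (Suc i)) = split_count m (\<lambda>i. w (Suc i))"
    using Suc.prems by (intro Suc.IH) auto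
  moreover have "(\<Sum>i=1..Suc m. v i) = (\<Sum>i=1..Suc m. w i)"
    using Suc.prems by (intro sum.cong) auto
  moreover have "v 1 = w 1" using Suc.prems by auto
  ultimately show ?case by simp
qed simp

section \<open>Evaluation of the sum over ordered partitions\<close>

lemma (in derivation_family) forest_nonempty:
  "B \<noteq> {} \<Longrightarrow> forest (Suc q) B = of_nat ((card B - 1) choose q) * (\<delta> ^^ (card B - 1 - q)) (\<Prod>h\<in>B. f h)"
  by (simp add: forest_def)

text \<open>Induction on the number of parts: for a fixed first part \<open>B\<close>, the others
  sum to a multiple of a forest term on \<open>A - B\<close>. Then \<open>sum_forest_forest\<close>
  with \<open>a = Min A\<close> sums over \<open>B\<close> and yields the binomial factor of
  \<open>split_count\<close>.\<close>

lemma sum_prod_forest: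
  fixes f :: "nat \<Rightarrow> 'a::comm_ring_1"
  assumes "derivation \<delta>" "finite A"
  shows "(\<Sum>s\<in>set_partitions_on A m. \<Prod>i=1..m. derivation_family.forest \<delta> f (Suc (v i)) (s i))
    = of_nat (split_count m v) * derivation_family.forest \<delta> f (m + (\<Sum>i=1..m. v i)) A"
proof -
  interpret derivation_family \<delta> f by unfold_locales fact
  show ?thesis
    using assms(2)
  proof (induction m arbitrary: A v)
    case 0
    have "set_partitions_on A 0 = (if A = {} then {\<lambda>_. undefined} else {})"
      by (auto simp: set_partitions_on_iff disjoint_family_on_def strict_mono_on_def)
    then show ?case by (simp add: forest_def)
  next
    case (Suc m)
    show ?case
    \<comment> \<open>Parts are non-empty, so there is no partition, and the right side asks for a
      positive number of trees on the empty set.\<close>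
    proof (cases "A = {}")
      case True
      then have "s \<notin> set_partitions_on A (Suc m)" for s
        unfolding set_partitions_on_iff atLeast1_atMost_Suc by auto
      then have "set_partitions_on A (Suc m) = {}" by blast
      then show ?thesis using True by (simp add: forest_def)
    next
      case False
      let ?v = "\<lambda>i. v (Suc i)"
      have "(\<Sum>s\<in>set_partitions_on A (Suc m). \<Prod>i=1..Suc m. forest (Suc (v i)) (s i))
          = (\<Sum>s\<in>set_partitions_on A (Suc m). forest (Suc (v 1)) (s 1)
              * (\<Prod>i=1..m. forest (Suc (?v i)) (tail m s i)))"
        unfolding prod_atLeast1_atMost_Suc by (simp add: tail_def)
      also have "\<dots> = (\<Sum>B\<in>{B. Min A \<in> B \<and> B \<subseteq> A}. \<Sum>t\<in>set_partitions_on (A - B) m.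
          forest (Suc (v 1)) B * (\<Prod>i=1..m. forest (Suc (?v i)) (t i)))"
        using sum_set_partitions_on_Suc[OF Suc.prems] .
      also have "\<dots> = (\<Sum>B\<in>{B. Min A \<in> B \<and> B \<subseteq> A}.
          of_nat (split_count m ?v) * (forest (Suc (v 1)) B * forest (m + (\<Sum>i=1..m. ?v i)) (A - B)))"
      proof (intro sum.cong refl)
        fix B
        have "(\<Sum>t\<in>set_partitions_on (A - B) m. forest (Suc (v 1)) B * (\<Prod>i=1..m. forest (Suc (?v i)) (t i)))
            = forest (Suc (v 1)) B * (\<Sum>t\<in>set_partitions_on (A - B) m. \<Prod>i=1..m. forest (Suc (?v i)) (t i))"
          by (rule sum_distrib_left[symmetric])
        also have "(\<Sum>t\<in>set_partitions_on (A - B) m. \<Prod>i=1..m. forest (Suc (?v i)) (t i))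
            = of_nat (split_count m ?v) * forest (m + (\<Sum>i=1..m. ?v i)) (A - B)"
          using Suc.prems by (intro Suc.IH) simp
        finally show "(\<Sum>t\<in>set_partitions_on (A - B) m.
            forest (Suc (v 1)) B * (\<Prod>i=1..m. forest (Suc (?v i)) (t i)))
          = of_nat (split_count m ?v) * (forest (Suc (v 1)) B * forest (m + (\<Sum>i=1..m. ?v i)) (A - B))"
          by (simp only: mult.left_commute)
      qed
      also have "\<dots> = of_nat (split_count m ?v) * (of_nat ((v 1 + (m + (\<Sum>i=1..m. ?v i))) choose v 1)
          * forest (Suc (v 1 + (m + (\<Sum>i=1..m. ?v i)))) A)"
        unfolding sum_distrib_left[symmetric] using Suc.prems False by (subst sum_forest_forest) auto
      also have "v 1 + (m + (\<Sum>i=1..m. ?v i)) = m + (\<Sum>i=1..Suc m. v i)"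
        unfolding sum_atLeast1_atMost_Suc by simp
      finally show ?thesis by (simp add: algebra_simps)
    qed
  qed
qed

section \<open>Summation over the increasing tuples\<close>

text \<open>The values move up by one and the indices stay, so tuples in \<open>{1..m}\<close>
  become tuples in \<open>{2..Suc m}\<close>.\<close>

definition shift :: "nat \<Rightarrow> (nat \<Rightarrow> nat) \<Rightarrow> nat \<Rightarrow> nat" where
  "shift k t = (\<lambda>i\<in>{1..k}. Suc (t i))"

definition unshift :: "nat \<Rightarrow> (nat \<Rightarrow> nat) \<Rightarrow> nat \<Rightarrow> nat" where
  "unshift k t = (\<lambda>i\<in>{1..k}. t i - 1)"

lemma increasing_tuples_iff:
  "t \<in> increasing_tuples m k \<longleftrightarrow>
     t \<in> extensional {1..k} \<and> (\<forall>i\<in>{1..k}. t i \<in> {1..m}) \<and> strict_mono_on {1..k} t"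
  unfolding increasing_tuples_def PiE_def Pi_def by auto

lemma finite_increasing_tuples: "finite (increasing_tuples m k)"
  by (rule finite_subset[of _ "{1..k} \<rightarrow>\<^sub>E {1..m}"]) (auto simp: increasing_tuples_def intro!: finite_PiE)

lemma unshift_shift: "t \<in> extensional {1..k} \<Longrightarrow> unshift k (shift k t) = t"
  by (auto simp: unshift_def shift_def extensional_def)

lemma shift_unshift:
  assumes "t \<in> extensional {1..k}" "\<And>i. i \<in> {1..k} \<Longrightarrow> t i \<noteq> 0"
  shows "shift k (unshift k t) = t"
proof
  fix i
  show "shift k (unshift k t) i = t i"
    using assms(1) assms(2)[of i] by (auto simp: unshift_def shift_def extensional_def)
qed

lemma shift_increasing_tuples:
  assumes "t \<in> increasing_tuples m k"
  shows "shift k t \<in> increasing_tuples (Suc m) k" "\<And>i. i \<in> {1..k} \<Longrightarrow> 1 < shift k t i"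
  using assms by (auto simp: increasing_tuples_iff shift_def strict_mono_on_def Suc_le_eq)

lemma unshift_increasing_tuples:
  assumes t: "t \<in> extensional {1..k}" "strict_mono_on {1..k} t" "\<And>i. i \<in> {1..k} \<Longrightarrow> t i \<in> {2..Suc m}"
  shows "unshift k t \<in> increasing_tuples m k"
proof -
  have "t i - 1 \<in> {1..m}" if "i \<in> {1..k}" for i
    using t(3)[OF that] by auto
  moreover have "t i - 1 < t l - 1" if "i \<in> {1..k}" "l \<in> {1..k}" "i < l" for i l
    using t(3)[OF that(1)] t(3)[OF that(2)] strict_mono_onD[OF t(2) that] by auto
  ultimately show ?thesis
    by (auto simp: increasing_tuples_iff unshift_def strict_mono_on_def)
qed

lemma sum_increasing_tuples_avoiding_1:
  "(\<Sum>\<tau>\<in>{\<tau> \<in> increasing_tuples (Suc m) k. 1 \<notin> \<tau> ` {1..k}}. h \<tau>)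
    = (\<Sum>t\<in>increasing_tuples m k. h (shift k t))"
proof (rule sum.reindex_bij_witness[where i="shift k" and j="unshift k"])
  fix \<tau> assume "\<tau> \<in> {\<tau> \<in> increasing_tuples (Suc m) k. 1 \<notin> \<tau> ` {1..k}}"
  then have \<tau>: "\<tau> \<in> extensional {1..k}" "strict_mono_on {1..k} \<tau>"
    and "\<And>i. i \<in> {1..k} \<Longrightarrow> \<tau> i \<in> {1..Suc m} \<and> \<tau> i \<noteq> 1"
    by (auto simp: increasing_tuples_iff) (metis atLeastAtMost_iff image_eqI)
  then have range: "\<tau> i \<in> {2..Suc m}" if "i \<in> {1..k}" for i
    using that by fastforce
  then have "\<tau> i \<noteq> 0" if "i \<in> {1..k}" for i
    using that by fastforce
  then show "shift k (unshift k \<tau>) = \<tau>"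
    using \<tau>(1) by (intro shift_unshift)
  then show "h (shift k (unshift k \<tau>)) = h \<tau>" by simp
  show "unshift k \<tau> \<in> increasing_tuples m k"
    using \<tau> range by (intro unshift_increasing_tuples)
next
  fix t assume t: "t \<in> increasing_tuples m k"
  then show "unshift k (shift k t) = t"
    by (intro unshift_shift) (simp add: increasing_tuples_iff)
  show "shift k t \<in> {\<tau> \<in> increasing_tuples (Suc m) k. 1 \<notin> \<tau> ` {1..k}}"
    using shift_increasing_tuples(1)[OF t] shift_increasing_tuples(2)[OF t]
    by (metis (no_types, lifting) imageE less_irrefl mem_Collect_eq)
qed

text \<open>An increasing tuple can take the value 1 only at its first index; the remaining values
  lie in \<open>{2..Suc m}\<close>.\<close>

lemma sum_increasing_tuples_containing_1:
  "(\<Sum>\<tau>\<in>{\<tau> \<in> increasing_tuples (Suc m) (Suc k). 1 \<in> \<tau> ` {1..Suc k}}. h \<tau>)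
    = (\<Sum>t\<in>increasing_tuples m k. h (prepend k 1 (shift k t)))"
proof (rule sum.reindex_bij_witness[where i="\<lambda>t. prepend k 1 (shift k t)" and j="\<lambda>\<tau>. unshift k (tail k \<tau>)"])
  fix \<tau> assume *: "\<tau> \<in> {\<tau> \<in> increasing_tuples (Suc m) (Suc k). 1 \<in> \<tau> ` {1..Suc k}}"
  then have \<tau>: "\<tau> \<in> extensional {1..Suc k}" "\<And>i. i \<in> {1..Suc k} \<Longrightarrow> \<tau> i \<in> {1..Suc m}"
    "\<And>i. i \<in> {1..k} \<Longrightarrow> \<tau> 1 < \<tau> (Suc i)" "strict_mono_on {1..k} (\<lambda>i. \<tau> (Suc i))"
    unfolding mem_Collect_eq increasing_tuples_iff strict_mono_on_Suc_iff by auto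
  have \<tau>1: "\<tau> 1 = 1"
  proof (rule ccontr)
    assume "\<tau> 1 \<noteq> 1"
    then obtain i where "i \<in> {1..k}" "\<tau> (Suc i) = 1"
      using * unfolding atLeast1_atMost_Suc by auto
    then show False using \<tau>(3)[of i] \<tau>(2)[of 1] by auto
  qed
  have tl: "tail k \<tau> \<in> extensional {1..k}" "strict_mono_on {1..k} (tail k \<tau>)"
    using \<tau>(4) by (auto simp: tail_def strict_mono_on_def)
  have range: "tail k \<tau> i \<in> {2..Suc m}" if "i \<in> {1..k}" for i
    using that \<tau>(3)[OF that] \<tau>(2)[of "Suc i"] \<tau>1 by (auto simp: tail_def)
  then have "tail k \<tau> i \<noteq> 0" if "i \<in> {1..k}" for i
    using that by fastforce
  then have "shift k (unshift k (tail k \<tau>)) = tail k \<tau>"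
    using tl(1) by (intro shift_unshift)
  then show "prepend k 1 (shift k (unshift k (tail k \<tau>))) = \<tau>"
    using prepend_tail[OF \<tau>(1)] \<tau>1 by simp
  then show "h (prepend k 1 (shift k (unshift k (tail k \<tau>)))) = h \<tau>" by simp
  show "unshift k (tail k \<tau>) \<in> increasing_tuples m k"
    using tl range by (intro unshift_increasing_tuples)
next
  fix t assume t: "t \<in> increasing_tuples m k"
  then have "unshift k (shift k t) = t"
    by (intro unshift_shift) (simp add: increasing_tuples_iff)
  moreover have "shift k t \<in> extensional {1..k}" by (simp add: shift_def)
  ultimately show "unshift k (tail k (prepend k 1 (shift k t))) = t"
    by (simp only: tail_prepend)
  note st = shift_increasing_tuples[OF t]
  have "strict_mono_on {1..k} (\<lambda>i. prepend k 1 (shift k t) (Suc i))"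
    using st(1) by (auto simp: increasing_tuples_iff strict_mono_on_def)
  moreover have "\<forall>i\<in>{1..Suc k}. prepend k 1 (shift k t) i \<in> {1..Suc m}"
    unfolding atLeast1_atMost_Suc[of k] using st(1) by (auto simp: increasing_tuples_iff)
  moreover have "prepend k 1 (shift k t) \<in> extensional {1..Suc k}"
    by (simp add: prepend_def)
  ultimately have "prepend k 1 (shift k t) \<in> increasing_tuples (Suc m) (Suc k)"
    unfolding increasing_tuples_iff strict_mono_on_Suc_iff using st(2) by auto
  moreover have "1 \<in> prepend k 1 (shift k t) ` {1..Suc k}"
    by (rule image_eqI[of _ _ 1]) auto
  ultimately show "prepend k 1 (shift k t) \<in> {\<tau> \<in> increasing_tuples (Suc m) (Suc k). 1 \<in> \<tau> ` {1..Suc k}}"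
    by simp
qed

text \<open>The transport of \<open>u\<close> along \<open>\<tau>\<close>. As a sum over fibres it
  preserves the total by regrouping; for injective \<open>\<tau>\<close> a fibre has at most one
  point.\<close>

definition extend :: "nat \<Rightarrow> (nat \<Rightarrow> nat) \<Rightarrow> (nat \<Rightarrow> nat) \<Rightarrow> nat \<Rightarrow> nat" where
  "extend k u \<tau> i = (\<Sum>l\<in>{l \<in> {1..k}. \<tau> l = i}. u l)"

lemma sum_extend:
  assumes "\<tau> \<in> increasing_tuples m k"
  shows "(\<Sum>i=1..m. extend k u \<tau> i) = (\<Sum>l=1..k. u l)"
  unfolding extend_def
  by (rule sum.group) (use assms in \<open>auto simp: increasing_tuples_iff\<close>)

lemma extend_notin: "i \<notin> \<tau> ` {1..k} \<Longrightarrow> extend k u \<tau> i = 0"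
  unfolding extend_def by (rule sum.neutral) auto

lemma inj_on_increasing_tuples: "\<tau> \<in> increasing_tuples m k \<Longrightarrow> inj_on \<tau> {1..k}"
  by (simp add: increasing_tuples_iff strict_mono_on_imp_inj_on)

lemma extend_apply:
  assumes "inj_on \<tau> {1..k}" "l \<in> {1..k}"
  shows "extend k u \<tau> (\<tau> l) = u l"
proof -
  have "{l' \<in> {1..k}. \<tau> l' = \<tau> l} = {l}"
    using assms by (auto dest: inj_onD)
  then show ?thesis by (simp add: extend_def)
qed

lemma extend_shift: "extend k u (shift k t) (Suc i) = extend k u t i"
  unfolding extend_def by (intro sum.cong) (auto simp: shift_def)

lemma extend_prepend:
  assumes "i \<noteq> 0"
  shows "extend (Suc k) u (prepend k 1 (shift k t)) (Suc i) = extend k (\<lambda>l. u (Suc l)) t i"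
  unfolding extend_def
proof (rule sum.reindex_bij_witness[where i=Suc and j="\<lambda>l. l - 1"])
  fix l assume "l \<in> {l \<in> {1..Suc k}. prepend k 1 (shift k t) l = Suc i}"
  then have l: "l \<in> {1..Suc k}" "prepend k 1 (shift k t) l = Suc i" by auto
  \<comment> \<open>Index 1 carries the value 1, whereas \<open>Suc i\<close> is at least 2.\<close>
  then have "l \<noteq> 1" using assms by auto
  then obtain l' where "l = Suc l'" "l' \<in> {1..k}"
    using l by (intro that[of "l - 1"]) auto
  then show "Suc (l - 1) = l" "l - 1 \<in> {l \<in> {1..k}. t l = i}" "u (Suc (l - 1)) = u l"
    using l by (auto simp: shift_def)
qed (auto simp: shift_def)

section \<open>Recursion and closed form for the total count\<close>

definition tuple_count :: "nat \<Rightarrow> nat \<Rightarrow> (nat \<Rightarrow> nat) \<Rightarrow> nat" where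
  "tuple_count m k u = (\<Sum>\<tau>\<in>increasing_tuples m k. split_count m (extend k u \<tau>))"

lemma sum_increasing_tuples_split:
  "(\<Sum>\<tau>\<in>increasing_tuples m k. h \<tau>)
    = (\<Sum>\<tau>\<in>{\<tau> \<in> increasing_tuples m k. 1 \<notin> \<tau> ` {1..k}}. h \<tau>)
    + (\<Sum>\<tau>\<in>{\<tau> \<in> increasing_tuples m k. 1 \<in> \<tau> ` {1..k}}. h \<tau>)"
  by (subst sum.union_disjoint[symmetric]) (auto simp: finite_increasing_tuples intro!: sum.cong)

text \<open>The first part has weight 0, so the leading binomial coefficient of
  \<open>split_count\<close> is 1.\<close>

lemma sum_split_count_shift:
  "(\<Sum>t\<in>increasing_tuples m k. split_count (Suc m) (extend k u (shift k t))) = tuple_count m k u"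
  unfolding tuple_count_def
proof (intro sum.cong refl)
  fix t assume t: "t \<in> increasing_tuples m k"
  have "extend k u (shift k t) 1 = 0"
    using shift_increasing_tuples(2)[OF t] by (intro extend_notin) force
  then show "split_count (Suc m) (extend k u (shift k t)) = split_count m (extend k u t)"
    by (simp add: extend_shift)
qed

text \<open>The first weight is \<open>u 1\<close> and the total weight is that of \<open>u\<close>
  for every tuple, so the leading binomial coefficient factors out.\<close>

lemma sum_split_count_prepend:
  "(\<Sum>t\<in>increasing_tuples m k. split_count (Suc m) (extend (Suc k) u (prepend k 1 (shift k t))))
    = ((m + (\<Sum>l=1..Suc k. u l)) choose u 1) * tuple_count m k (\<lambda>l. u (Suc l))"
  unfolding tuple_count_def sum_distrib_left
proof (intro sum.cong refl)
  fix t assume t: "t \<in> increasing_tuples m k"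
  let ?\<tau> = "prepend k 1 (shift k t)"
  let ?v = "extend (Suc k) u ?\<tau>"
  have "{l \<in> {1..Suc k}. ?\<tau> l = 1} = {1}"
    using shift_increasing_tuples(2)[OF t] unfolding atLeast1_atMost_Suc by force
  then have v1: "?v 1 = u 1" by (simp add: extend_def)
  have "(\<Sum>i=1..m. ?v (Suc i)) = (\<Sum>i=1..m. extend k (\<lambda>l. u (Suc l)) t i)"
    by (intro sum.cong extend_prepend) auto
  then have "(\<Sum>i=1..Suc m. ?v i) = (\<Sum>l=1..Suc k. u l)"
    using sum_extend[OF t, of "\<lambda>l. u (Suc l)"] unfolding sum_atLeast1_atMost_Suc v1 by simp
  moreover have "split_count m (\<lambda>i. ?v (Suc i)) = split_count m (extend k (\<lambda>l. u (Suc l)) t)"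
    by (intro split_count_cong extend_prepend) auto
  ultimately show "split_count (Suc m) ?v
      = ((m + (\<Sum>l=1..Suc k. u l)) choose u 1) * split_count m (extend k (\<lambda>l. u (Suc l)) t)"
    using v1 by simp
qed

lemma tuple_count_Suc_0: "tuple_count (Suc m) 0 u = tuple_count m 0 u"
  unfolding tuple_count_def[of "Suc m"]
  by (subst sum_increasing_tuples_split)
     (simp only: sum_increasing_tuples_avoiding_1 sum_split_count_shift, simp)

lemma tuple_count_Suc_Suc:
  "tuple_count (Suc m) (Suc k) u = tuple_count m (Suc k) u
    + ((m + (\<Sum>l=1..Suc k. u l)) choose u 1) * tuple_count m k (\<lambda>l. u (Suc l))"
  unfolding tuple_count_def[of "Suc m"]
  by (subst sum_increasing_tuples_split)
     (simp only: sum_increasing_tuples_avoiding_1 sum_increasing_tuples_containing_1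
        sum_split_count_shift sum_split_count_prepend)

lemma tuple_count_0: "tuple_count 0 k u = (if k = 0 then 1 else 0)"
proof (cases k)
  case 0
  then have "increasing_tuples 0 k = {\<lambda>_. undefined}"
    by (auto simp: increasing_tuples_iff strict_mono_on_def)
  then show ?thesis using 0 by (simp add: tuple_count_def)
next
  case (Suc k')
  have "t \<notin> increasing_tuples 0 k" for t
    unfolding increasing_tuples_iff Suc atLeast1_atMost_Suc by auto
  then have "increasing_tuples 0 k = {}" by blast
  then show ?thesis using Suc by (simp add: tuple_count_def)
qed

text \<open>The last product in the denominator of \<open>C_coeff\<close>; its factors are the tail
  sums of \<open>u g + 1\<close>.\<close>

definition tail_product :: "nat \<Rightarrow> (nat \<Rightarrow> nat) \<Rightarrow> nat" where
  "tail_product k u = (\<Prod>i=1..k. k - i + 1 + (\<Sum>g=i..k. u g))"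

lemma tail_product_Suc:
  "tail_product (Suc k) u = (Suc k + (\<Sum>i=1..Suc k. u i)) * tail_product k (\<lambda>i. u (Suc i))"
  unfolding tail_product_def prod_atLeast1_atMost_Suc sum.shift_bounds_cl_Suc_ivl diff_Suc_Suc
  by simp

text \<open>Over the common denominator, the two terms of the recursion become \<open>m - k'\<close>
  and \<open>Suc k' + U\<close> times \<open>fact (m + U)\<close>, where \<open>k = Suc k'\<close>
  and \<open>U\<close> is the sum of \<open>u\<close>. These factors add up to
  \<open>Suc (m + U)\<close>.\<close>

lemma tuple_count_closed_form:
  "tuple_count m k u * (fact (m - k) * (\<Prod>i=1..k. fact (u i)) * tail_product k u)
    = (if k \<le> m then fact (m + (\<Sum>i=1..k. u i)) else 0)"
proof (induction m arbitrary: k u)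
  case 0
  then show ?case by (simp add: tuple_count_0 tail_product_def)
next
  case (Suc m)
  show ?case
  proof (cases k)
    case 0
    then show ?thesis using Suc.IH[of 0 u] by (simp add: tuple_count_Suc_0 tail_product_def)
  next
    case k: (Suc k')
    define u' where "u' = (\<lambda>i. u (Suc i))"
    define U where "U = (\<Sum>i=1..k. u i)"
    define U' where "U' = (\<Sum>i=1..k'. u' i)"
    define Q where "Q = (\<Prod>i=1..k'. fact (u' i) :: nat)"
    define D where "D = tail_product k' u'"
    have U: "U = u 1 + U'" unfolding U_def U'_def u'_def k by (rule sum_atLeast1_atMost_Suc)
    have Q: "(\<Prod>i=1..k. fact (u i)) = fact (u 1) * Q"
      unfolding Q_def u'_def k by (rule prod_atLeast1_atMost_Suc)
    have D: "tail_product k u = (Suc k' + U) * D"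
      unfolding D_def U_def u'_def k by (rule tail_product_Suc)
    define K1 where "K1 = tuple_count m k u"
    define K2 where "K2 = tuple_count m k' u'"
    have K: "tuple_count (Suc m) k u = K1 + ((m + U) choose u 1) * K2"
      unfolding K1_def K2_def U_def u'_def k by (rule tuple_count_Suc_Suc)
    define T where "T = fact (u 1) * Q * ((Suc k' + U) * D)"
    have IH1: "K1 * (fact (m - k) * T) = (if k \<le> m then fact (m + U) else 0)"
      using Suc.IH[of k u] unfolding K1_def Q D U_def T_def by (simp only: mult.assoc)
    have IH2: "K2 * (fact (m - k') * Q * D) = (if k' \<le> m then fact (m + U') else 0)"
      using Suc.IH[of k' u'] unfolding K2_def Q_def D_def U'_def .
    have "tuple_count (Suc m) k u * (fact (Suc m - k) * (\<Prod>i=1..k. fact (u i)) * tail_product k u)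
        = (K1 + ((m + U) choose u 1) * K2) * (fact (m - k') * T)"
      unfolding K Q D T_def by (simp only: k diff_Suc_Suc mult.assoc)
    also have "\<dots> = (if k' \<le> m then fact (Suc m + U) else 0)"
    proof (cases "k' \<le> m")
      case True
      \<comment> \<open>For \<open>k \<le> m\<close>, one factor comes out of
        \<open>fact (m - k')\<close>; for \<open>m = k'\<close>, both sides are 0.\<close>
      have 1: "K1 * (fact (m - k') * T) = (m - k') * fact (m + U)"
      proof (cases "k \<le> m")
        case True
        then have "m - k' = Suc (m - k)" using k by simp
        then have "fact (m - k') = (m - k') * fact (m - k)" by simp
        then have "K1 * (fact (m - k') * T) = (m - k') * (K1 * (fact (m - k) * T))"
          by (simp only: mult_ac)
        then show ?thesis using True by (simp only: IH1 if_True)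
      next
        case False
        then have "m = k'" using k True by simp
        then show ?thesis using IH1 False by auto
      qed
      \<comment> \<open>The complementary lower index is \<open>m + U'\<close>, as
        \<open>U = u 1 + U'\<close>.\<close>
      have fact_eq: "fact (u 1) * fact (m + U') * ((m + U) choose u 1) = fact (m + U)"
        using binomial_fact_lemma[of "u 1" "m + U"] U by (simp add: add.commute)
      have "((m + U) choose u 1) * K2 * (fact (m - k') * T)
          = (Suc k' + U) * (fact (u 1) * (K2 * (fact (m - k') * Q * D)) * ((m + U) choose u 1))"
        unfolding T_def by (simp only: mult_ac)
      then have 2: "((m + U) choose u 1) * K2 * (fact (m - k') * T) = (Suc k' + U) * fact (m + U)"
        using True by (simp only: IH2 if_True fact_eq)
      have "(m - k') * fact (m + U) + (Suc k' + U) * fact (m + U) = (m - k' + (Suc k' + U)) * fact (m + U)"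
        by (simp only: distrib_right)
      also have "m - k' + (Suc k' + U) = Suc (m + U)" using True by simp
      finally show ?thesis using True by (simp only: distrib_right 1 2) simp
    next
      case False
      \<comment> \<open>Both subtractions truncate to 0, so the factorials of the differences are
        1.\<close>
      then have "K1 * T = 0" "K2 * (Q * D) = 0"
        using IH1 IH2 k by auto
      then show ?thesis using False by (auto simp: T_def)
    qed
    finally show ?thesis by (simp add: k U_def)
  qed
qed

section \<open>The formula for \<open>F_sum\<close>\<close>

lemma F_sum_eq_sum_forest:
  fixes f :: "nat \<Rightarrow> 'a::comm_ring_1"
  assumes "derivation \<delta>"
  shows "F_sum \<delta> N j k f u = (\<Sum>\<tau>\<in>increasing_tuples (N - j) k. \<Sum>s\<in>set_partitions_on {1..N} (N - j).
    \<Prod>i=1..N - j. derivation_family.forest \<delta> f (Suc (extend k u \<tau> i)) (s i))"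
proof -
  interpret derivation_family \<delta> f by unfold_locales fact
  let ?m = "N - j"
  show ?thesis
    unfolding F_sum_def set_partitions_on_def[symmetric] set_partitions_def
  proof (intro sum.cong refl)
    fix \<tau> s
    assume \<tau>: "\<tau> \<in> increasing_tuples ?m k" and "s \<in> set_partitions_on {1..N} ?m"
    then have s: "s i \<noteq> {}" if "i \<in> {1..?m}" for i
      using that by (auto simp: set_partitions_on_iff)
    have im: "\<tau> ` {1..k} \<subseteq> {1..?m}"
      using \<tau> by (auto simp: increasing_tuples_iff)
    have s_\<tau>: "s (\<tau> l) \<noteq> {}" if "l \<in> {1..k}" for l
      using im that by (intro s) blast
    note inj = inj_on_increasing_tuples[OF \<tau>]
    \<comment> \<open>The parts indexed by the image of \<open>\<tau>\<close> carry
      \<open>u l + 1\<close> trees, all others a single tree.\<close>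
    have "(\<Prod>i=1..?m. forest (Suc (extend k u \<tau> i)) (s i))
        = (\<Prod>i\<in>\<tau> ` {1..k}. forest (Suc (extend k u \<tau> i)) (s i))
          * (\<Prod>i\<in>{1..?m} - \<tau> ` {1..k}. forest (Suc (extend k u \<tau> i)) (s i))"
      using prod.subset_diff[OF im] by (simp add: mult.commute)
    also have "(\<Prod>i\<in>\<tau> ` {1..k}. forest (Suc (extend k u \<tau> i)) (s i))
        = (\<Prod>i=1..k. of_nat ((card (s (\<tau> i)) - 1) choose u i) *
            (\<delta> ^^ (card (s (\<tau> i)) - 1 - u i)) (\<Prod>h\<in>s (\<tau> i). f h))"
      unfolding prod.reindex[OF inj] o_def
      by (intro prod.cong refl) (simp only: extend_apply[OF inj] forest_nonempty[OF s_\<tau>])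
    also have "(\<Prod>i\<in>{1..?m} - \<tau> ` {1..k}. forest (Suc (extend k u \<tau> i)) (s i))
        = (\<Prod>i\<in>{1..?m} - \<tau> ` {1..k}. (\<delta> ^^ (card (s i) - 1)) (\<Prod>h\<in>s i. f h))"
      using s by (intro prod.cong refl) (simp add: extend_notin forest_nonempty)
    finally show "(\<Prod>i=1..k. of_nat ((card (s (\<tau> i)) - 1) choose u i) *
            (\<delta> ^^ (card (s (\<tau> i)) - 1 - u i)) (\<Prod>h\<in>s (\<tau> i). f h)) *
          (\<Prod>i\<in>{1..?m} - \<tau> ` {1..k}. (\<delta> ^^ (card (s i) - 1)) (\<Prod>h\<in>s i. f h))
        = (\<Prod>i=1..?m. forest (Suc (extend k u \<tau> i)) (s i))" by simp
  qed
qed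

lemma F_sum_eq_tuple_count:
  fixes f :: "nat \<Rightarrow> 'a::comm_ring_1"
  assumes "derivation \<delta>" "j < N"
  shows "F_sum \<delta> N j k f u
    = of_nat (tuple_count (N - j) k u * ((N - 1) choose (N - j + (\<Sum>i=1..k. u i) - 1)))
      * (\<delta> ^^ (j - (\<Sum>i=1..k. u i))) (\<Prod>i=1..N. f i)"
proof -
  interpret derivation_family \<delta> f by unfold_locales fact
  let ?U = "\<Sum>i=1..k. u i"
  have "F_sum \<delta> N j k f u = (\<Sum>\<tau>\<in>increasing_tuples (N - j) k.
      of_nat (split_count (N - j) (extend k u \<tau>)) * forest (N - j + ?U) {1..N})"
    unfolding F_sum_eq_sum_forest[OF assms(1)]
    by (intro sum.cong refl) (simp only: sum_prod_forest[OF assms(1) finite_atLeastAtMost] sum_extend)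
  also have "\<dots> = of_nat (tuple_count (N - j) k u) * forest (N - j + ?U) {1..N}"
    by (simp add: tuple_count_def sum_distrib_right)
  also have "forest (N - j + ?U) {1..N}
      = of_nat ((N - 1) choose (N - j + ?U - 1)) * (\<delta> ^^ (j - ?U)) (\<Prod>i=1..N. f i)"
  proof -
    \<comment> \<open>If \<open>?U\<close> exceeds \<open>j\<close>, both differences truncate to 0
      and the binomial coefficient vanishes.\<close>
    have "N - (N - j + ?U) = j - ?U" using assms(2) by simp
    then show ?thesis using assms(2) by (simp add: forest_def)
  qed
  finally show ?thesis by (simp add: mult.assoc)
qed

text \<open>Let \<open>U\<close> be the sum of \<open>u\<close>. The closed form has numerator
  \<open>fact (N - j + U)\<close>, the binomial coefficient has \<open>fact (N - j + U - 1)\<close>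
  in its denominator; their quotient is the linear factor of \<open>C_coeff\<close>.\<close>

lemma C_coeff_eq_tuple_count:
  assumes "j < N" "k \<le> N - j"
  shows "C_coeff j N k u
    = of_nat (tuple_count (N - j) k u * ((N - 1) choose (N - j + (\<Sum>i=1..k. u i) - 1)))"
proof -
  define U where "U = (\<Sum>i=1..k. u i)"
  define D where "D = (fact (N - j - k) * (\<Prod>i=1..k. fact (u i)) * tail_product k u :: nat)"
  define K where "K = tuple_count (N - j) k u"
  show ?thesis
  proof (cases "U \<le> j")
    case True
    have "K * D = fact (N - j + U)"
      using tuple_count_closed_form[of "N - j" k u] assms(2)
      unfolding K_def D_def U_def by (simp only: if_True)
    also have "\<dots> = (N - j + U) * fact (N - j + U - 1)"
      using assms by (simp add: fact_reduce)
    finally have KD: "K * D = (N - j + U) * fact (N - j + U - 1)" .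
    have fact_eq: "fact (N - j + U - 1) * fact (j - U) * ((N - 1) choose (N - j + U - 1)) = (fact (N - 1) :: nat)"
      using binomial_fact_lemma[of "N - j + U - 1" "N - 1"] assms True by simp
    have "K * ((N - 1) choose (N - j + U - 1)) * (D * fact (j - U))
        = K * D * (fact (j - U) * ((N - 1) choose (N - j + U - 1)))"
      by (simp only: mult_ac)
    also have "\<dots> = fact (N - j + U - 1) * fact (j - U) * ((N - 1) choose (N - j + U - 1)) * (N - j + U)"
      unfolding KD by (simp only: mult_ac)
    finally have "fact (N - 1) * (N - j + U) = K * ((N - 1) choose (N - j + U - 1)) * (D * fact (j - U))"
      unfolding fact_eq by (rule sym)
    then have "(of_nat (fact (N - 1) * (N - j + U)) :: rat)
        = of_nat (K * ((N - 1) choose (N - j + U - 1))) * of_nat (D * fact (j - U))"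
      by (simp only: of_nat_mult[symmetric])
    moreover have "D * fact (j - U) \<noteq> 0"
      by (auto simp: D_def tail_product_def)
    ultimately have "(of_nat (fact (N - 1) * (N - j + U)) :: rat) / of_nat (D * fact (j - U))
        = of_nat (K * ((N - 1) choose (N - j + U - 1)))"
      by (metis nonzero_mult_div_cancel_right of_nat_eq_0_iff)
    moreover have "C_coeff j N k u = of_nat (fact (N - 1) * (N - j + U)) / of_nat (D * fact (j - U))"
      using True unfolding C_coeff_def D_def U_def tail_product_def
      by (simp add: of_nat_prod mult_ac)
    ultimately show ?thesis by (simp only: K_def U_def)
  next
    case False
    \<comment> \<open>The lower index exceeds \<open>N - 1\<close>, in accordance with the value 0
      of \<open>C_coeff\<close> for \<open>U > j\<close>.\<close>
    then have "(N - 1) choose (N - j + U - 1) = 0"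
      using assms by (intro binomial_eq_0) simp
    then show ?thesis using False by (simp add: C_coeff_def U_def)
  qed
qed

theorem theorem6p4:
  fixes \<delta> :: "'a::comm_ring_1 \<Rightarrow> 'a"
    and N j k :: nat
    and u :: "nat \<Rightarrow> nat"
    and f :: "nat \<Rightarrow> 'a"
  assumes "derivation \<delta>"
    and "j < N"
    and "k \<le> N - j"
  shows "\<exists>c::int. of_int c = C_coeff j N k u \<and>
           F_sum \<delta> N j k f u = of_int c * (\<delta> ^^ (j - (\<Sum>i=1..k. u i))) (\<Prod>i=1..N. f i)"
proof -
  \<comment> \<open>The rational coefficient is a natural number, so it acts on the ring without any
    division.\<close>
  let ?c = "int (tuple_count (N - j) k u * ((N - 1) choose (N - j + (\<Sum>i=1..k. u i) - 1)))"
  show ?thesis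
    using F_sum_eq_tuple_count[OF assms(1,2), of k f u] C_coeff_eq_tuple_count[OF assms(2,3), of u]
    by (intro exI[of _ ?c]) (simp only: of_int_of_nat_eq)
qed

end
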